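(* Consider the fully dynamic online uncapacitated facility location problem with uniform opening cost $1$ (defined in the context) and the following online Algorithm 1. Insertion: when a new demand point $x$ arrives, let $y$ be its nearest open facility and $d'=\min\{\mathrm{dist}(x,y),1\}$. With probability $d'$ open a new facility at $x$ and assign $x$ to it; otherwise assign $x$ to $y$ and set $p_x:=d'$ (stored for future use). Deletion: if the deleted point is not an open facility, just remove it. If it is an open facility, remove it and reassign every point that was assigned to it as follows: for such a point $x$, let $y$ be its nearest open facility and $d'=\min\{\mathrm{dist}(x,y),1\}$, and let $p_x$ be the last value stored for $x$. If $d'\le 2p_x$, assign $x$ to $y$; otherwise, with probability $d'$ open a new facility at $x$ (and assign $x$ to it), and with probability $1-d'$ assign $x$ to $y$ and set $p_x:=d'$. Then Algorithm 1 is $O(\log N/\log\log N)$-competitive, where $N$ is the number of active clients at the end of the input sequence.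
   Context: Fully dynamic online uncapacitated facility location: points come from an arbitrary metric space (possibly unknown to the algorithm). Requests arrive online; each request either inserts a new demand point (client) or deletes a previously inserted one. When a point $x$ arrives, the algorithm must immediately and irrevocably decide whether to open a facility at $x$ and then assign $x$ to some open facility (possibly itself). When a point is deleted it leaves the system; if it was an open facility, all points assigned to it are reassigned, and some of them may become open facilities. Every facility has opening cost $1$. The cost of the solution for the set $\mathcal X$ of active points is $|\mathcal F|+\sum_{x\in\mathcal X}\mathrm{dist}(x,\mathfrak a(x))$, where $\mathcal F$ is the set of open facilities and $\mathfrak a(x)$ the facility to which $x$ is assigned. A randomized algorithm is $\alpha$-competitive if for every input sequence its expected cost is at most $\alpha$ times the cost of an optimal offline facility location solution for the clients active at the end of the sequence (facilities may be opened at any client location).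
   Formalization: With the test d' ≤ 2p_x the claim fails: if p_x = 1/2, x may be sent arbitrarily far. Proved instead: the claim with test dist(x,y) ≤ 2p_x in every metric space, and for the test as written a ratio D·O(log N/log log N) when the diameter is at most D (D ≥ 1). *)

theory Defs
  imports "HOL-Probability.Probability" "HOL-Library.Landau_Symbols"
begin

text \<open>
  A client is a label that is used for one insertion only.  Its position in the metric space is
  given by a separate map, so distinct clients may sit at the same point, and a point that was
  deleted may be requested again under a new label.
\<close>

type_synonym client = nat

datatype request = Insert client | Delete client

definition client_dist :: "('a \<Rightarrow> 'a \<Rightarrow> real) \<Rightarrow> (client \<Rightarrow> 'a) \<Rightarrow> client \<Rightarrow> client \<Rightarrow> real" where
  "client_dist d loc x y = d (loc x) (loc y)"

text \<open>The set \<open>U\<close> contains the labels used so far and \<open>A\<close> the clients that are active.\<close>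

fun valid_from :: "client set \<Rightarrow> client set \<Rightarrow> request list \<Rightarrow> bool" where
  "valid_from U A [] \<longleftrightarrow> True"
| "valid_from U A (Insert x # rs) \<longleftrightarrow> x \<notin> U \<and> valid_from (insert x U) (insert x A) rs"
| "valid_from U A (Delete x # rs) \<longleftrightarrow> x \<in> A \<and> valid_from U (A - {x}) rs"

definition valid_requests :: "request list \<Rightarrow> bool" where
  "valid_requests rs \<longleftrightarrow> valid_from {} {} rs"

fun active_from :: "client set \<Rightarrow> request list \<Rightarrow> client set" where
  "active_from A [] = A"
| "active_from A (Insert x # rs) = active_from (insert x A) rs"
| "active_from A (Delete x # rs) = active_from (A - {x}) rs"

definition final_clients :: "request list \<Rightarrow> client set" where
  "final_clients rs = active_from {} rs"

definition solution_cost ::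
  "(client \<Rightarrow> client \<Rightarrow> real) \<Rightarrow> client set \<Rightarrow> client set \<Rightarrow> (client \<Rightarrow> client) \<Rightarrow> real" where
  "solution_cost \<delta> A F a = real (card F) + (\<Sum>x\<in>A. \<delta> x (a x))"

definition opt_cost :: "(client \<Rightarrow> client \<Rightarrow> real) \<Rightarrow> client set \<Rightarrow> real" where
  "opt_cost \<delta> A = Inf {solution_cost \<delta> A F a | F a. F \<subseteq> A \<and> (\<forall>x\<in>A. a x \<in> F)}"

text \<open>
  The field \<open>stored\<close> holds the values \<open>p\<^sub>x\<close>; it is meaningful only for active clients that
  are not open facilities.
\<close>

record config =
  active :: "client set"
  facilities :: "client set"
  assigned :: "client \<Rightarrow> client"
  stored :: "client \<Rightarrow> real"

definition initial_config :: config where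
  "initial_config =
     \<lparr>active = {}, facilities = {}, assigned = (\<lambda>x. x), stored = (\<lambda>_. 0)\<rparr>"

text \<open>
  The algorithm leaves open how ties between nearest facilities are broken and in which order the
  clients of a deleted facility are treated.  Both choices are parameters, and competitiveness
  will be claimed for all of them.
\<close>

definition nearest_rule ::
  "(client \<Rightarrow> client \<Rightarrow> real) \<Rightarrow> (config \<Rightarrow> client \<Rightarrow> client) \<Rightarrow> bool" where
  "nearest_rule \<delta> near \<longleftrightarrow>
     (\<forall>s x. finite (facilities s) \<and> facilities s \<noteq> {} \<longrightarrow>
        is_arg_min (\<delta> x) (\<lambda>y. y \<in> facilities s) (near s x))"

definition clients_of :: "config \<Rightarrow> client \<Rightarrow> client set" where
  "clients_of s f = {x \<in> active s - {f}. assigned s x = f}"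

definition order_rule :: "(config \<Rightarrow> client \<Rightarrow> client list) \<Rightarrow> bool" where
  "order_rule ord \<longleftrightarrow>
     (\<forall>s f. finite (active s) \<longrightarrow> distinct (ord s f) \<and> set (ord s f) = clients_of s f)"

text \<open>
  Without any open facility the distance to the nearest one counts as infinite, hence the capped
  distance is 1 and the client becomes a facility.
\<close>

definition capped_dist ::
  "(client \<Rightarrow> client \<Rightarrow> real) \<Rightarrow> (config \<Rightarrow> client \<Rightarrow> client) \<Rightarrow> config \<Rightarrow> client \<Rightarrow> real" where
  "capped_dist \<delta> near s x =
     (if facilities s = {} then 1 else min (\<delta> x (near s x)) 1)"

text \<open>This random choice is used both for insertions and for reassignments.\<close>

definition open_or_assign ::
  "(client \<Rightarrow> client \<Rightarrow> real) \<Rightarrow> (config \<Rightarrow> client \<Rightarrow> client) \<Rightarrow> client \<Rightarrow> config \<Rightarrow> config pmf" where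
  "open_or_assign \<delta> near x s =
     map_pmf
       (\<lambda>b. if b
            then s\<lparr>facilities := insert x (facilities s), assigned := (assigned s)(x := x)\<rparr>
            else s\<lparr>assigned := (assigned s)(x := near s x),
                   stored := (stored s)(x := capped_dist \<delta> near s x)\<rparr>)
       (bernoulli_pmf (capped_dist \<delta> near s x))"

text \<open>
  A test takes the distance \<open>t\<close> from a client \<open>x\<close> to its nearest open facility and \<open>p\<^sub>x\<close>, and
  decides whether \<open>x\<close> is reassigned to that facility without a new random choice.  With
  \<open>capped_test\<close> this happens whenever \<open>1 \<le> 2 * p\<^sub>x\<close>, however large \<open>t\<close> is, so the connection
  cost is not bounded by any function of the optimum: insert \<open>y\<close>, insert \<open>x\<close> at distance
  \<open>1/2\<close> from \<open>y\<close>, insert \<open>z\<close> at distance \<open>D\<close> from both, and delete \<open>y\<close>; with probability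
  \<open>1/2\<close> the client \<open>x\<close> ends up assigned to \<open>z\<close>, while the optimum is at most 2.
  The two tests agree if \<open>t \<le> 1\<close> or \<open>t \<le> 2 * p\<^sub>x\<close> or \<open>p\<^sub>x < 1/2\<close>.
\<close>

definition capped_test :: "real \<Rightarrow> real \<Rightarrow> bool" where
  "capped_test t p \<longleftrightarrow> min t 1 \<le> 2 * p"

definition uncapped_test :: "real \<Rightarrow> real \<Rightarrow> bool" where
  "uncapped_test t p \<longleftrightarrow> t \<le> 2 * p"

definition reassign ::
  "(real \<Rightarrow> real \<Rightarrow> bool) \<Rightarrow> (client \<Rightarrow> client \<Rightarrow> real) \<Rightarrow> (config \<Rightarrow> client \<Rightarrow> client) \<Rightarrow>
   client \<Rightarrow> config \<Rightarrow> config pmf" where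
  "reassign test \<delta> near x s =
     (if facilities s \<noteq> {} \<and> test (\<delta> x (near s x)) (stored s x)
      then return_pmf (s\<lparr>assigned := (assigned s)(x := near s x)\<rparr>)
      else open_or_assign \<delta> near x s)"

text \<open>Clients are treated one after another, so a facility opened on the way is available to later ones.\<close>

fun reassign_all ::
  "(real \<Rightarrow> real \<Rightarrow> bool) \<Rightarrow> (client \<Rightarrow> client \<Rightarrow> real) \<Rightarrow> (config \<Rightarrow> client \<Rightarrow> client) \<Rightarrow>
   client list \<Rightarrow> config \<Rightarrow> config pmf" where
  "reassign_all test \<delta> near [] s = return_pmf s"
| "reassign_all test \<delta> near (x # xs) s =
     bind_pmf (reassign test \<delta> near x s) (reassign_all test \<delta> near xs)"

fun handle_request ::
  "(real \<Rightarrow> real \<Rightarrow> bool) \<Rightarrow> (client \<Rightarrow> client \<Rightarrow> real) \<Rightarrow> (config \<Rightarrow> client \<Rightarrow> client) \<Rightarrow>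
   (config \<Rightarrow> client \<Rightarrow> client list) \<Rightarrow> request \<Rightarrow> config \<Rightarrow> config pmf" where
  "handle_request test \<delta> near ord (Insert x) s =
     open_or_assign \<delta> near x (s\<lparr>active := insert x (active s)\<rparr>)"
| "handle_request test \<delta> near ord (Delete x) s =
     (let s' = s\<lparr>active := active s - {x}, facilities := facilities s - {x}\<rparr>
      in if x \<in> facilities s then reassign_all test \<delta> near (ord s x) s' else return_pmf s')"

fun run_from ::
  "(real \<Rightarrow> real \<Rightarrow> bool) \<Rightarrow> (client \<Rightarrow> client \<Rightarrow> real) \<Rightarrow> (config \<Rightarrow> client \<Rightarrow> client) \<Rightarrow>
   (config \<Rightarrow> client \<Rightarrow> client list) \<Rightarrow> request list \<Rightarrow> config \<Rightarrow> config pmf" where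
  "run_from test \<delta> near ord [] s = return_pmf s"
| "run_from test \<delta> near ord (r # rs) s =
     bind_pmf (handle_request test \<delta> near ord r s) (run_from test \<delta> near ord rs)"

definition algorithm1 ::
  "(real \<Rightarrow> real \<Rightarrow> bool) \<Rightarrow> (client \<Rightarrow> client \<Rightarrow> real) \<Rightarrow> (config \<Rightarrow> client \<Rightarrow> client) \<Rightarrow>
   (config \<Rightarrow> client \<Rightarrow> client list) \<Rightarrow> request list \<Rightarrow> config pmf" where
  "algorithm1 test \<delta> near ord rs = run_from test \<delta> near ord rs initial_config"

definition config_cost :: "(client \<Rightarrow> client \<Rightarrow> real) \<Rightarrow> config \<Rightarrow> real" where
  "config_cost \<delta> s = solution_cost \<delta> (active s) (facilities s) (assigned s)"

text \<open>The ratio \<open>\<alpha>\<close> is a function of the number of clients that are active at the end.\<close>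

definition competitive ::
  "(client \<Rightarrow> client \<Rightarrow> real) \<Rightarrow> (request list \<Rightarrow> config pmf) \<Rightarrow> (nat \<Rightarrow> real) \<Rightarrow> bool" where
  "competitive \<delta> alg \<alpha> \<longleftrightarrow>
     (\<forall>rs. valid_requests rs \<longrightarrow>
        measure_pmf.expectation (alg rs) (config_cost \<delta>)
          \<le> \<alpha> (card (final_clients rs)) * opt_cost \<delta> (final_clients rs))"

end

theory Submission
  imports Defs "HOL-Real_Asymp.Real_Asymp"
begin

text \<open>
  Fix the final clients \<open>A\<close>.  A random choice of \<open>x\<close> with success probability \<open>p\<close> costs at most a
  constant times \<open>p\<close> in expectation, and the success probabilities of the choices of one client at
  least double.  Split each cluster of a solution \<open>(F, a)\<close> into a central ball and rings around its
  centre, with radii \<open>b\<^sup>j / N\<close>.  As final clients are never deleted, a facility that opens at a final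
  client of a ring stays, and the choices in the ring up to that moment have expected total success
  probability at most 1.  Afterwards every choice of a client \<open>x\<close> of the ring has success
  probability at most \<open>m x = (1 + b) dist(x, a x) + 1 / N\<close>, so that their total is at most
  \<open>2 m x\<close>.  Only about \<open>log\<^sub>b N\<close> rings have radius below 1, and the clients outside them pay at most a
  constant anyway.  The choice \<open>b = 2 + sqrt (ln N)\<close> balances the two contributions.  The
  amortisation is carried out by a potential function that is a supermartingale.
\<close>

section \<open>Random steps with an invariant and a bounded expectation\<close>

text \<open>Finite support turns every expectation into a finite sum, so no integrability condition
  has to be carried along a run.\<close>

definition bounded_step :: "('s \<Rightarrow> bool) \<Rightarrow> ('s \<Rightarrow> real) \<Rightarrow> real \<Rightarrow> 's pmf \<Rightarrow> bool" where
  "bounded_step I \<Phi> v p \<longleftrightarrow>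
     finite (set_pmf p) \<and> (\<forall>s\<in>set_pmf p. I s) \<and> measure_pmf.expectation p \<Phi> \<le> v"

lemma bounded_step_return: "I s \<Longrightarrow> \<Phi> s \<le> v \<Longrightarrow> bounded_step I \<Phi> v (return_pmf s)"
  by (simp add: bounded_step_def)

text \<open>The supermartingale property composes by the tower rule; \<open>q\<close> has to be
  controlled only at states with \<open>I\<close>, which include the support of
  \<open>p\<close>.\<close>

lemma bounded_step_bind:
  assumes p: "bounded_step I \<Phi> v p"
    and q: "\<And>s. I s \<Longrightarrow> bounded_step J \<Phi> (\<Phi> s) (q s)"
  shows "bounded_step J \<Phi> v (bind_pmf p q)"
proof -
  have fin: "finite (set_pmf p)" and I: "\<And>s. s \<in> set_pmf p \<Longrightarrow> I s"
    using p by (auto simp: bounded_step_def)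
  have "measure_pmf.expectation (bind_pmf p q) \<Phi> =
        (\<Sum>s\<in>set_pmf p. pmf p s *\<^sub>R measure_pmf.expectation (q s) \<Phi>)"
    using fin I q by (intro pmf_expectation_bind) (auto simp: bounded_step_def)
  also have "\<dots> \<le> (\<Sum>s\<in>set_pmf p. pmf p s *\<^sub>R \<Phi> s)"
    using I q by (intro sum_mono scaleR_left_mono) (auto simp: bounded_step_def)
  also have "\<dots> = measure_pmf.expectation p \<Phi>"
    using fin by (subst integral_measure_pmf[of "set_pmf p"]) auto
  finally show ?thesis
    using p q I by (auto simp: bounded_step_def)
qed

section \<open>The potential function\<close>

text \<open>
  The constant \<open>K\<close> is 2 for the uncapped test and \<open>2 * D\<close> for the capped one.
\<close>

locale amortised_analysis =
  fixes \<delta> :: "client \<Rightarrow> client \<Rightarrow> real"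
    and near :: "config \<Rightarrow> client \<Rightarrow> client"
    and ord :: "config \<Rightarrow> client \<Rightarrow> client list"
    and test :: "real \<Rightarrow> real \<Rightarrow> bool"
    and K :: real
    and A :: "client set"
    and G :: "'g set"
    and g :: "client \<Rightarrow> 'g"
    and m :: "client \<Rightarrow> real"
  assumes dist_nonneg: "\<And>x y. 0 \<le> \<delta> x y"
    and dist_refl: "\<And>x. \<delta> x x = 0"
    and near_rule: "nearest_rule \<delta> near"
    and ord_rule: "order_rule ord"
    and K_ge_2: "2 \<le> K"
    and test_pass: "\<And>x y p. 0 \<le> p \<Longrightarrow> test (\<delta> x y) p \<Longrightarrow> \<delta> x y \<le> K * p"
    and test_fail: "\<And>t p. \<not> test t p \<Longrightarrow> 2 * p \<le> t"
    and finite_A: "finite A"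
    and finite_G: "finite G"
    and m_nonneg: "\<And>x. x \<in> A \<Longrightarrow> 0 \<le> m x"
    and group_cases: "\<And>x. x \<in> A \<Longrightarrow> 1 \<le> m x \<or>
           g x \<in> G \<and> (\<forall>z\<in>A. g z = g x \<longrightarrow> \<delta> x z \<le> m x)"
begin

text \<open>Prepays the future choices of a client made with probability at most \<open>m'\<close>.
  When the probability at least doubles from \<open>p\<close> to \<open>d\<close>, the release
  \<open>2 * (1 + K) * (d - p)\<close> is at least \<open>(1 + K) * d\<close>.\<close>

definition reserve :: "real \<Rightarrow> real \<Rightarrow> real" where
  "reserve m' p = 2 * (1 + K) * max 0 (m' - p)"

text \<open>\<open>K * stored s x\<close> bounds the connection cost of an assigned client. A final
  client that has not arrived yet has stored value 0 and holds its full reserve.\<close>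

definition weight :: "config \<Rightarrow> client \<Rightarrow> real" where
  "weight s x =
     (if x \<in> facilities s then 1 else K * stored s x + reserve (m x) (stored s x))"

definition unhit :: "config \<Rightarrow> 'g set" where
  "unhit s = G - g ` (A \<inter> facilities s)"

text \<open>The sum ranges over the final clients from the start. Each unhit group holds
  \<open>1 + K\<close> for the choices up to its first open final client.\<close>

definition potential :: "config \<Rightarrow> real" where
  "potential s = (\<Sum>x\<in>A. weight s x) + (1 + K) * real (card (unhit s))"

text \<open>
  \<open>U\<close> is the set of used labels, \<open>B\<close> the set of active clients, and \<open>X\<close> contains the clients that
  still wait for a (re)assignment.
\<close>

definition inv :: "client set \<Rightarrow> client set \<Rightarrow> client set \<Rightarrow> config \<Rightarrow> bool" where
  "inv U B X s \<longleftrightarrow> finite U \<and> B \<subseteq> U \<and> active s = B \<and> facilities s \<subseteq> B \<and>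
     X \<subseteq> B - facilities s \<and> (\<forall>x. 0 \<le> stored s x) \<and> (\<forall>x. x \<notin> U \<longrightarrow> stored s x = 0) \<and>
     (\<forall>x\<in>facilities s. assigned s x = x) \<and>
     (\<forall>x\<in>B - facilities s - X. assigned s x \<in> facilities s \<and>
        \<delta> x (assigned s x) \<le> K * stored s x)"

lemma finite_facilities: "inv U B X s \<Longrightarrow> finite (facilities s)"
  by (auto simp: inv_def intro: finite_subset)

lemma stored_nonneg: "inv U B X s \<Longrightarrow> 0 \<le> stored s x"
  by (simp add: inv_def)

lemma near_facility:
  assumes "finite (facilities s)" "facilities s \<noteq> {}"
  shows "near s x \<in> facilities s" and "z \<in> facilities s \<Longrightarrow> \<delta> x (near s x) \<le> \<delta> x z"
proof -
  have "is_arg_min (\<delta> x) (\<lambda>y. y \<in> facilities s) (near s x)"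
    using near_rule assms by (simp add: nearest_rule_def)
  then show "near s x \<in> facilities s" "z \<in> facilities s \<Longrightarrow> \<delta> x (near s x) \<le> \<delta> x z"
    unfolding is_arg_min_def by (simp, force simp: not_less)
qed

lemma capped_dist_bounds: "0 \<le> capped_dist \<delta> near s x" "capped_dist \<delta> near s x \<le> 1"
  by (auto simp: capped_dist_def dist_nonneg)

text \<open>If \<open>u = 1\<close>, the choice is paid for by the credit \<open>1 + K\<close> of an unhit group, otherwise by the reserve.\<close>

lemma choice_amortised:
  assumes p: "0 \<le> p" and d: "0 \<le> d" "d \<le> 1" "2 * p \<le> d \<or> d = 1"
    and u: "u = 1 \<or> u = 0 \<and> d \<le> M"
  shows "1 * d + (K * d + reserve M d + (1 + K) * u) * (1 - d) \<le>
         K * p + reserve M p + (1 + K) * u"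
proof -
  have K: "0 < 1 + K" using K_ge_2 by linarith
  have res_nonneg: "0 \<le> reserve M q" for q
    unfolding reserve_def using K by simp
  have u0: "0 \<le> u" using u by auto
  have Kp: "0 \<le> K * p" using p K_ge_2 by simp
  show ?thesis
  proof (cases "2 * p \<le> d")
    case False
    \<comment> \<open>The client opens for certain; its old term \<open>K * p\<close> is already at
      least 1, the weight of a facility.\<close>
    then have "d = 1" "1/2 \<le> p" using d by auto
    then have "1 \<le> K * p" using K_ge_2 mult_mono[of 2 K "1/2" p] by simp
    moreover have "0 \<le> (1 + K) * u" using K u0 by simp
    ultimately show ?thesis using res_nonneg[of p] \<open>d = 1\<close> by simp
  next
    case True
    have mono: "reserve M d \<le> reserve M p"
      unfolding reserve_def using K True p d by (intro mult_left_mono) auto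
    from u show ?thesis
    proof
      \<comment> \<open>Opening has probability \<open>d\<close> and releases the credit, in
        expectation \<open>(1 + K) * d\<close>. This covers the expected weight \<open>d\<close> of
        a new facility and the new term \<open>K * d\<close>.\<close>
      assume u: "u = 1"
      have "reserve M d * (1 - d) \<le> reserve M d"
        using mult_left_mono[of "1 - d" 1 "reserve M d"] res_nonneg[of d] d by simp
      moreover have "0 \<le> K * d * d" using K_ge_2 d by simp
      ultimately show ?thesis using u mono Kp by (simp add: algebra_simps)
    next
      assume u: "u = 0 \<and> d \<le> M"
      have "(K * d + reserve M d) * (1 - d) \<le> K * d + reserve M d"
        using mult_left_mono[of "1 - d" 1 "K * d + reserve M d"] res_nonneg[of d] d K_ge_2 by simp
      \<comment> \<open>Neither maximum is cut off at 0, since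
        \<open>p \<le> d \<le> M\<close>.\<close>
      moreover have "reserve M p = reserve M d + 2 * (1 + K) * (d - p)"
        unfolding reserve_def using u True p by (simp add: algebra_simps)
      moreover have "(1 + K) * d \<le> (1 + K) * (2 * (d - p))"
        using True K by (intro mult_left_mono) auto
      ultimately show ?thesis using u Kp by (simp add: algebra_simps)
    qed
  qed
qed

text \<open>Only the choice of a final client can change the potential, and then only through its
  own weight and the state of its group; this reduces the claim to
  \<open>choice_amortised\<close>.\<close>

lemma choice_potential:
  assumes I: "inv U B X s" and x: "x \<notin> facilities s"
    and d: "d = capped_dist \<delta> near s x" "2 * stored s x \<le> d \<or> d = 1"
  shows "potential (s\<lparr>facilities := insert x (facilities s), assigned := h\<rparr>) * d +
         potential (s\<lparr>assigned := h', stored := (stored s)(x := d)\<rparr>) * (1 - d) \<le> potential s"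
    (is "potential ?s1 * d + potential ?s0 * (1 - d) \<le> _")
proof (cases "x \<in> A")
  case False
  have "weight ?s1 y = weight s y" "weight ?s0 y = weight s y" if "y \<in> A" for y
    using that False by (auto simp: weight_def)
  moreover have "unhit ?s1 = unhit s" "unhit ?s0 = unhit s"
    using False by (auto simp: unhit_def)
  ultimately have "potential ?s1 = potential s" "potential ?s0 = potential s"
    by (auto simp: potential_def cong: sum.cong)
  then show ?thesis by (simp add: algebra_simps)
next
  case True
  define W where "W = (\<Sum>y\<in>A - {x}. weight s y)"
  define u :: real where "u = (if g x \<in> unhit s then 1 else 0)"
  have "weight ?s1 y = weight s y" "weight ?s0 y = weight s y" if "y \<in> A - {x}" for y
    using that by (auto simp: weight_def)
  then have "(\<Sum>y\<in>A - {x}. weight ?s1 y) = W" "(\<Sum>y\<in>A - {x}. weight ?s0 y) = W"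
    unfolding W_def by (auto intro: sum.cong)
  then have sums: "(\<Sum>y\<in>A. weight ?s1 y) = weight ?s1 x + W"
    "(\<Sum>y\<in>A. weight ?s0 y) = weight ?s0 x + W" "(\<Sum>y\<in>A. weight s y) = weight s x + W"
    unfolding W_def using True finite_A by (simp_all add: sum.remove[of A x])
  have ws: "weight ?s1 x = 1" "weight ?s0 x = K * d + reserve (m x) d"
    "weight s x = K * stored s x + reserve (m x) (stored s x)"
    using x by (simp_all add: weight_def)
  have "unhit ?s1 = unhit s - {g x}" "unhit ?s0 = unhit s"
    using True by (auto simp: unhit_def)
  moreover have "finite (unhit s)" using finite_G by (simp add: unhit_def)
  ultimately have cards: "real (card (unhit s)) = u + real (card (unhit ?s1))" "unhit ?s0 = unhit s"
    unfolding u_def using card.remove[of "unhit s" "g x"] by auto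
  have d01: "0 \<le> d" "d \<le> 1" using d capped_dist_bounds by auto
  have "u = 1 \<or> u = 0 \<and> d \<le> m x"
  proof (cases "1 \<le> m x \<or> g x \<in> unhit s")
    case True
    then show ?thesis using d01 by (auto simp: u_def)
  next
    case False
    \<comment> \<open>The group is hit, so an open final client \<open>z\<close> within
      \<open>m x\<close> bounds the distance to the nearest facility.\<close>
    then obtain z where z: "z \<in> A" "z \<in> facilities s" "g z = g x" "\<delta> x z \<le> m x"
      using group_cases[OF \<open>x \<in> A\<close>] by (auto simp: unhit_def)
    have "d \<le> \<delta> x (near s x)" using d z by (auto simp: capped_dist_def)
    also have "\<dots> \<le> m x"
      using near_facility(2)[OF finite_facilities[OF I], of z x] z by fastforce
    finally show ?thesis using False by (simp add: u_def)
  qed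
  moreover have "0 \<le> stored s x" using I by (simp add: inv_def)
  ultimately have "1 * d + (K * d + reserve (m x) d + (1 + K) * u) * (1 - d) \<le>
      K * stored s x + reserve (m x) (stored s x) + (1 + K) * u"
    using d d01 by (intro choice_amortised) auto
  then show ?thesis
    unfolding potential_def sums ws cards by (simp add: algebra_simps)
qed

text \<open>The value \<open>p\<close> is free so that the lemma serves a failed choice, with
  \<open>p\<close> the new probability, as well as a passed test, with \<open>p\<close> the old
  stored value.\<close>

lemma inv_assign:
  assumes I: "inv U B X s" and x: "x \<in> X" and y: "y \<in> facilities s"
    and p: "0 \<le> p" "\<delta> x y \<le> K * p"
  shows "inv U B (X - {x}) (s\<lparr>assigned := (assigned s)(x := y), stored := (stored s)(x := p)\<rparr>)"
proof -
  have x': "x \<notin> facilities s" "x \<in> U" using I x by (auto simp: inv_def)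
  have rest: "assigned s z \<in> facilities s \<and> \<delta> z (assigned s z) \<le> K * stored s z"
    if "z \<in> B" "z \<notin> facilities s" "z \<notin> X" for z
    using I that unfolding inv_def by blast
  show ?thesis
    unfolding inv_def
  proof (intro conjI)
    let ?s = "s\<lparr>assigned := (assigned s)(x := y), stored := (stored s)(x := p)\<rparr>"
    show "\<forall>z\<in>B - facilities ?s - (X - {x}). assigned ?s z \<in> facilities ?s \<and>
        \<delta> z (assigned ?s z) \<le> K * stored ?s z"
      using rest y p by auto
  qed (use I x x' p in \<open>auto simp: inv_def\<close>)
qed

lemma inv_choice:
  assumes I: "inv U B X s" and x: "x \<in> X"
    and s': "s' \<in> set_pmf (open_or_assign \<delta> near x s)"
  shows "inv U B (X - {x}) s'"
proof -
  define d where "d = capped_dist \<delta> near s x"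
  have d01: "0 \<le> d" "d \<le> 1" unfolding d_def by (rule capped_dist_bounds)+
  from s' obtain b where b: "b \<in> set_pmf (bernoulli_pmf d)"
    and s'_eq: "s' = (if b
            then s\<lparr>facilities := insert x (facilities s), assigned := (assigned s)(x := x)\<rparr>
            else s\<lparr>assigned := (assigned s)(x := near s x), stored := (stored s)(x := d)\<rparr>)"
    by (auto simp: open_or_assign_def d_def)
  show ?thesis
  proof (cases b)
    case True
    then show ?thesis using I x unfolding inv_def s'_eq by auto
  next
    case False
    \<comment> \<open>Failure has positive probability only for \<open>d < 1\<close>; then some
      facility is open and the cap is inactive, so the true distance is \<open>d\<close>.\<close>
    with b d01 have "d < 1" by (auto simp: set_pmf_iff)
    then have "facilities s \<noteq> {}" and d: "\<delta> x (near s x) = d"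
      by (auto simp: d_def capped_dist_def split: if_splits)
    then have "near s x \<in> facilities s"
      using near_facility(1) finite_facilities[OF I] by blast
    moreover have "d \<le> K * d" using K_ge_2 d01 mult_right_mono[of 1 K d] by simp
    ultimately show ?thesis using inv_assign[OF I x] False d d01 unfolding s'_eq by simp
  qed
qed

lemma open_or_assign_step:
  assumes I: "inv U B X s" and x: "x \<in> X"
    and d: "2 * stored s x \<le> capped_dist \<delta> near s x \<or> capped_dist \<delta> near s x = 1"
  shows "bounded_step (inv U B (X - {x})) potential (potential s) (open_or_assign \<delta> near x s)"
proof -
  have "finite (set_pmf (open_or_assign \<delta> near x s))"
    by (simp add: open_or_assign_def)
  moreover have "measure_pmf.expectation (open_or_assign \<delta> near x s) potential \<le> potential s"
    unfolding open_or_assign_def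
    using choice_potential[OF I _ refl d, of "(assigned s)(x := x)" "(assigned s)(x := near s x)"] I x
    by (auto simp: capped_dist_bounds inv_def)
  ultimately show ?thesis
    using inv_choice[OF I x] by (auto simp: bounded_step_def)
qed

section \<open>The potential along a run\<close>

text \<open>A passed test keeps the stored value and hence the potential. After a failed one the
  capped distance is at least twice the stored value or equals 1; without facilities it is 1 as
  well.\<close>

lemma reassign_step:
  assumes I: "inv U B X s" and x: "x \<in> X"
  shows "bounded_step (inv U B (X - {x})) potential (potential s) (reassign test \<delta> near x s)"
proof (cases "facilities s \<noteq> {} \<and> test (\<delta> x (near s x)) (stored s x)")
  case True
  let ?s = "s\<lparr>assigned := (assigned s)(x := near s x)\<rparr>"
  have "\<delta> x (near s x) \<le> K * stored s x"
    using True stored_nonneg[OF I] by (intro test_pass) auto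
  moreover have "near s x \<in> facilities s"
    using near_facility(1) finite_facilities[OF I] True by blast
  ultimately have "inv U B (X - {x}) ?s"
    using inv_assign[OF I x, of "near s x" "stored s x"] stored_nonneg[OF I] by simp
  moreover have "weight ?s = weight s" "unhit ?s = unhit s"
    by (auto simp: weight_def unhit_def)
  then have "potential ?s = potential s"
    by (simp add: potential_def)
  ultimately show ?thesis
    using True by (auto simp: reassign_def intro!: bounded_step_return)
next
  case False
  have "2 * stored s x \<le> capped_dist \<delta> near s x \<or> capped_dist \<delta> near s x = 1"
    using False test_fail[of "\<delta> x (near s x)" "stored s x"]
    by (auto simp: capped_dist_def min_def)
  then show ?thesis
    using False open_or_assign_step[OF I x] by (auto simp: reassign_def)
qed

lemma reassign_all_step:
  assumes "inv U B X s" "distinct xs" "set xs = X"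
  shows "bounded_step (inv U B {}) potential (potential s) (reassign_all test \<delta> near xs s)"
  using assms
proof (induction xs arbitrary: X s)
  case Nil
  then show ?case by (auto intro: bounded_step_return)
next
  case (Cons x xs)
  have "bounded_step (inv U B (X - {x})) potential (potential s) (reassign test \<delta> near x s)"
    using Cons.prems by (intro reassign_step) auto
  moreover have "set xs = X - {x}" using Cons.prems by auto
  ultimately show ?case
    using Cons.prems Cons.IH by (auto intro!: bounded_step_bind)
qed

text \<open>A fresh label has stored value 0, so the doubling condition is trivial and an arrival is
  an ordinary choice.\<close>

lemma insert_step:
  assumes I: "inv U B {} s" and x: "x \<notin> U"
  shows "bounded_step (inv (insert x U) (insert x B) {}) potential (potential s)
           (handle_request test \<delta> near ord (Insert x) s)"
proof -
  let ?s = "s\<lparr>active := insert x (active s)\<rparr>"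
  have I': "inv (insert x U) (insert x B) {x} ?s" using I x by (auto simp: inv_def)
  have "stored ?s x = 0" using I x by (auto simp: inv_def)
  then have "bounded_step (inv (insert x U) (insert x B) ({x} - {x})) potential (potential ?s)
      (open_or_assign \<delta> near x ?s)"
    using I' by (intro open_or_assign_step) (auto simp: capped_dist_bounds)
  moreover have "weight ?s = weight s" "unhit ?s = unhit s"
    by (auto simp: weight_def unhit_def)
  then have "potential ?s = potential s"
    by (simp add: potential_def)
  ultimately show ?thesis by simp
qed

text \<open>No term of the potential depends on a client outside \<open>A\<close>, so the removal
  itself leaves it unchanged. The clients that lose their facility become the waiting set of the
  invariant.\<close>

lemma delete_step:
  assumes I: "inv U B {} s" and x: "x \<in> B" "x \<notin> A"
  shows "bounded_step (inv U (B - {x}) {}) potential (potential s)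
           (handle_request test \<delta> near ord (Delete x) s)"
proof -
  let ?s = "s\<lparr>active := active s - {x}, facilities := facilities s - {x}\<rparr>"
  have "weight ?s y = weight s y" if "y \<in> A" for y
    using that x by (auto simp: weight_def)
  moreover have "unhit ?s = unhit s"
    using x by (auto simp: unhit_def)
  ultimately have pot: "potential ?s = potential s"
    by (auto simp: potential_def cong: sum.cong)
  show ?thesis
  proof (cases "x \<in> facilities s")
    case True
    have "finite (active s)" using I finite_subset by (auto simp: inv_def)
    then have o: "distinct (ord s x)" "set (ord s x) = clients_of s x"
      using ord_rule by (auto simp: order_rule_def)
    have "inv U (B - {x}) (clients_of s x) ?s"
      using I by (auto simp: inv_def clients_of_def)
    from reassign_all_step[OF this o] show ?thesis
      using True pot by (simp add: Let_def)
  next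
    case False
    then have "inv U (B - {x}) {} ?s" using I by (auto simp: inv_def)
    then show ?thesis using False pot by (auto simp: Let_def intro!: bounded_step_return)
  qed
qed

text \<open>Labels are never reused, so a deleted client cannot be active at the end; hence no final
  client is ever deleted.\<close>

lemma active_from_used:
  "valid_from U B rs \<Longrightarrow> B \<subseteq> U \<Longrightarrow> active_from B rs \<inter> U \<subseteq> B"
  by (induction U B rs rule: valid_from.induct) auto

lemma run_step:
  assumes "inv U B {} s" "valid_from U B rs" "active_from B rs = A"
  shows "bounded_step (\<lambda>s. \<exists>U. inv U A {} s) potential (potential s) (run_from test \<delta> near ord rs s)"
  using assms
proof (induction rs arbitrary: U B s)
  case Nil
  then show ?case by (auto intro!: bounded_step_return)
next
  case (Cons r rs)
  show ?case
  proof (cases r)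
    case (Insert x)
    then have "bounded_step (inv (insert x U) (insert x B) {}) potential (potential s)
        (handle_request test \<delta> near ord r s)"
      using Cons.prems insert_step by auto
    then show ?thesis
      using Cons.prems Cons.IH Insert by (auto intro!: bounded_step_bind)
  next
    case (Delete x)
    have BU: "B \<subseteq> U" using Cons.prems(1) by (simp add: inv_def)
    then have "A \<inter> U \<subseteq> B - {x}"
      using Cons.prems Delete active_from_used[of U "B - {x}" rs] by auto
    then have "x \<in> B" "x \<notin> A" using Cons.prems(2) Delete BU by auto
    then have "bounded_step (inv U (B - {x}) {}) potential (potential s)
        (handle_request test \<delta> near ord r s)"
      using Cons.prems(1) delete_step Delete by auto
    then show ?thesis
      using Cons.prems Cons.IH Delete by (auto intro!: bounded_step_bind)
  qed
qed

section \<open>Cost against potential\<close>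

lemma config_cost_le_potential:
  assumes I: "inv U A {} s"
  shows "config_cost \<delta> s \<le> potential s"
proof -
  have F: "facilities s \<subseteq> A" "active s = A" using I by (auto simp: inv_def)
  \<comment> \<open>The facility count is spread over \<open>A\<close>, so that cost and weight can
    be compared client by client.\<close>
  have "config_cost \<delta> s = (\<Sum>x\<in>A. (if x \<in> facilities s then 1 else 0) + \<delta> x (assigned s x))"
    using F finite_A
    by (simp add: config_cost_def solution_cost_def sum.distrib sum.If_cases Int_absorb1)
  also have "\<dots> \<le> (\<Sum>x\<in>A. weight s x)"
  proof (rule sum_mono)
    fix x assume x: "x \<in> A"
    have res: "0 \<le> reserve (m x) (stored s x)" using K_ge_2 by (simp add: reserve_def)
    show "(if x \<in> facilities s then 1 else 0) + \<delta> x (assigned s x) \<le> weight s x"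
    proof (cases "x \<in> facilities s")
      case True
      then have "assigned s x = x" using I unfolding inv_def by blast
      then show ?thesis using True by (simp add: weight_def dist_refl)
    next
      case False
      then have "\<delta> x (assigned s x) \<le> K * stored s x" using I x unfolding inv_def by blast
      then show ?thesis using False res by (simp add: weight_def)
    qed
  qed
  also have "\<dots> \<le> potential s"
    using K_ge_2 by (simp add: potential_def)
  finally show ?thesis .
qed

lemma expected_cost_le:
  assumes "valid_requests rs" "final_clients rs = A"
  shows "measure_pmf.expectation (algorithm1 test \<delta> near ord rs) (config_cost \<delta>) \<le>
    (1 + K) * (real (card G) + 2 * (\<Sum>x\<in>A. m x))"
proof -
  let ?p = "algorithm1 test \<delta> near ord rs"
  have "inv {} {} {} initial_config"
    by (simp add: inv_def initial_config_def)
  then have step: "bounded_step (\<lambda>s. \<exists>U. inv U A {} s) potential (potential initial_config) ?p"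
    unfolding algorithm1_def using assms
    by (intro run_step) (auto simp: valid_requests_def final_clients_def)
  have "measure_pmf.expectation ?p (config_cost \<delta>) \<le> measure_pmf.expectation ?p potential"
    using step config_cost_le_potential
    by (intro integral_mono_AE) (auto simp: bounded_step_def AE_measure_pmf_iff
          intro!: integrable_measure_pmf_finite)
  also have "\<dots> \<le> potential initial_config" using step by (simp add: bounded_step_def)
  \<comment> \<open>Initially all stored values are 0 and all groups are unhit, so the weights are
    \<open>2 * (1 + K) * m x\<close>.\<close>
  also have "\<dots> = (1 + K) * (real (card G) + 2 * (\<Sum>x\<in>A. m x))"
    using m_nonneg
    by (simp add: potential_def weight_def unhit_def initial_config_def reserve_def
        flip: sum_distrib_left cong: sum.cong) (simp add: algebra_simps)
  finally show ?thesis .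
qed

end

section \<open>Clusters and rings\<close>

text \<open>With \<open>b = 2 + sqrt (ln N)\<close> this is \<open>6 + 2 * b + ln N / ln b\<close>,
  the sum of the coefficients of \<open>card F\<close> and of the connection cost in the final
  estimate. The summand 2 in \<open>b\<close> keeps \<open>ln b\<close> positive for small
  \<open>N\<close>.\<close>

definition ratio :: "nat \<Rightarrow> real" where
  "ratio N = 6 + 2 * (2 + sqrt (ln (real N))) + ln (real N) / ln (2 + sqrt (ln (real N)))"

text \<open>The term \<open>sqrt (ln N)\<close> is of lower order, and
  \<open>ln (2 + sqrt (ln N))\<close> is asymptotically half of \<open>ln (ln N)\<close>.\<close>

lemma ratio_bigo: "ratio \<in> O(\<lambda>N. ln (real N) / ln (ln (real N)))"
  unfolding ratio_def by real_asymp

lemma ratio_nonneg: "0 \<le> ratio N"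
proof -
  have "0 \<le> ln (real N)" by (cases "N = 0") auto
  moreover from this have "0 \<le> ln (2 + sqrt (ln (real N)))"
    using real_sqrt_ge_zero[of "ln (real N)"] by (intro ln_ge_zero) linarith
  ultimately show ?thesis by (simp add: ratio_def)
qed

lemma expected_cost_le_solution:
  fixes \<delta> :: "client \<Rightarrow> client \<Rightarrow> real"
  assumes nonneg: "\<And>x y. 0 \<le> \<delta> x y" and refl: "\<And>x. \<delta> x x = 0"
    and triangle: "\<And>x y z. \<delta> x z \<le> \<delta> x y + \<delta> z y"
    and near: "nearest_rule \<delta> near" and ord: "order_rule ord" and K: "2 \<le> K"
    and pass: "\<And>x y p. 0 \<le> p \<Longrightarrow> test (\<delta> x y) p \<Longrightarrow> \<delta> x y \<le> K * p"
    and fail: "\<And>t p. \<not> test t p \<Longrightarrow> 2 * p \<le> t"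
    and rs: "valid_requests rs" "final_clients rs = A" and fin: "finite A"
    and F: "F \<subseteq> A" "\<forall>x\<in>A. a x \<in> F"
  shows "measure_pmf.expectation (algorithm1 test \<delta> near ord rs) (config_cost \<delta>)
    \<le> (1 + K) * ratio (card A) * solution_cost \<delta> A F a"
proof -
  define N where "N = card A"
  define b where "b = 2 + sqrt (ln (real N))"
  \<comment> \<open>Since \<open>b ^ k\<close> is at least \<open>N\<close>, clients in rings beyond
    index \<open>k\<close> are at distance more than 1 from their centre.\<close>
  define k where "k = nat \<lceil>log b (real N)\<rceil>"
  define ring where "ring x = (LEAST j. \<delta> x (a x) * real N \<le> b ^ j)" for x
  \<comment> \<open>For \<open>x\<close> and \<open>z\<close> in one ring, \<open>z\<close> is
    within \<open>b * \<delta> x (a x) + 1 / N\<close> of the centre; the term \<open>1 / N\<close>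
    is the radius of the central ball, where distances to the centre are not comparable.\<close>
  define m where "m x = (1 + b) * \<delta> x (a x) + 1 / real N" for x
  define S where "S = (\<Sum>x\<in>A. \<delta> x (a x))"
  have lnN: "0 \<le> ln (real N)" by (cases "N = 0") auto
  have b: "2 \<le> b" using lnN by (simp add: b_def)
  have ring_le: "\<delta> x (a x) * real N \<le> b ^ ring x" for x
  proof -
    obtain n where "\<delta> x (a x) * real N < b ^ n" using real_arch_pow[of b] b by auto
    then show ?thesis
      unfolding ring_def using LeastI[of "\<lambda>j. \<delta> x (a x) * real N \<le> b ^ j" n] by simp
  qed
  \<comment> \<open>Minimality of the index gives the factor \<open>b\<close>; the summand 1 covers
    index 0.\<close>
  have ring_ge: "b ^ ring x \<le> 1 + b * (\<delta> x (a x) * real N)" for x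
  proof (cases "ring x")
    case 0
    then show ?thesis using b nonneg[of x "a x"] by simp
  next
    case (Suc j)
    then have "\<not> \<delta> x (a x) * real N \<le> b ^ j"
      using not_less_Least[of j "\<lambda>j. \<delta> x (a x) * real N \<le> b ^ j"] by (simp add: ring_def)
    then have "b * b ^ j \<le> b * (\<delta> x (a x) * real N)" using b by (intro mult_left_mono) auto
    then show ?thesis using Suc by simp
  qed
  have Npos: "0 < real N" if "x \<in> A" for x
    using that fin by (auto simp: N_def card_gt_0_iff)
  have bk: "real N \<le> b ^ k" if "0 < real N"
  proof -
    have "real N = b powr (log b (real N))" using b that by simp
    also have "\<dots> \<le> b powr (real k)"
      using b by (intro powr_mono) (auto simp: k_def, linarith)
    also have "\<dots> = b ^ k" using b by (simp add: powr_realpow)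
    finally show ?thesis .
  qed
  have m_nonneg: "0 \<le> m x" for x using b nonneg[of x "a x"] by (simp add: m_def)
  have groups: "1 \<le> m x \<or> (a x, ring x) \<in> F \<times> {..k} \<and>
      (\<forall>z\<in>A. (a z, ring z) = (a x, ring x) \<longrightarrow> \<delta> x z \<le> m x)" if x: "x \<in> A" for x
  proof (cases "ring x \<le> k")
    case True
    have "\<delta> x z \<le> m x" if z: "z \<in> A" "a z = a x" "ring z = ring x" for z
    proof -
      have "\<delta> z (a x) * real N \<le> 1 + b * (\<delta> x (a x) * real N)"
        using ring_le[of z] ring_ge[of x] z by simp
      then have "\<delta> z (a x) \<le> 1 / real N + b * \<delta> x (a x)"
        using Npos[OF x] by (simp add: field_simps)
      then show ?thesis using triangle[of x z "a x"] by (simp add: m_def algebra_simps)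
    qed
    then show ?thesis using True x F by auto
  next
    case False
    then have "\<not> \<delta> x (a x) * real N \<le> b ^ k"
      using not_less_Least[of k "\<lambda>j. \<delta> x (a x) * real N \<le> b ^ j"] by (simp add: ring_def)
    then have "real N < \<delta> x (a x) * real N" using bk Npos[OF x] by linarith
    then have "1 < \<delta> x (a x)" using Npos[OF x] by simp
    then have "1 * 1 \<le> (1 + b) * \<delta> x (a x)" using b by (intro mult_mono) auto
    then show ?thesis by (simp add: m_def add_increasing2)
  qed
  interpret amortised_analysis \<delta> near ord test K A "F \<times> {..k}" "\<lambda>x. (a x, ring x)" m
    using nonneg refl near ord K pass fail fin finite_subset[OF F(1) fin] m_nonneg groups
    by unfold_locales auto
  have S: "0 \<le> S" unfolding S_def using nonneg by (simp add: sum_nonneg)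
  \<comment> \<open>For nonempty \<open>A\<close> the terms \<open>1 / N\<close> add up to 1, which
    is absorbed by \<open>card F\<close> because \<open>F\<close> is nonempty.\<close>
  have "(\<Sum>x\<in>A. m x) \<le> (1 + b) * S + real (card F)"
  proof (cases "A = {}")
    case False
    then obtain x where "x \<in> A" by blast
    then have "F \<noteq> {}" using F by auto
    then have "1 \<le> card F" using F fin finite_subset by (metis Suc_leI One_nat_def card_gt_0_iff)
    then show ?thesis using Npos[OF \<open>x \<in> A\<close>]
      by (simp add: m_def S_def sum.distrib sum_distrib_left N_def)
  qed (use S b in simp)
  moreover have "real k \<le> ln (real N) / ln b + 1"
    using lnN b by (simp add: k_def log_def)
  then have "real (card F) * real (Suc k) \<le> real (card F) * (ln (real N) / ln b + 2)"
    by (intro mult_left_mono) auto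
  ultimately have "real (card (F \<times> {..k})) + 2 * (\<Sum>x\<in>A. m x)
      \<le> real (card F) * (ln (real N) / ln b + 2) + 2 * ((1 + b) * S + real (card F))"
    unfolding card_cartesian_product card_atMost of_nat_mult by (intro add_mono) simp_all
  also have "\<dots> \<le> ratio N * (real (card F) + S)"
  proof -
    define L where "L = ln (real N) / ln b"
    have "0 \<le> L" using lnN b by (simp add: L_def)
    \<comment> \<open>Exactly the surplus of the right side over the left one after expanding the
      product.\<close>
    then have "0 \<le> 2 * (1 + b) * real (card F) + (L + 4) * S"
      using b S by simp
    moreover have "ratio N = 6 + 2 * b + L" by (simp add: ratio_def b_def L_def)
    ultimately show ?thesis unfolding L_def[symmetric] by (simp add: algebra_simps)
  qed
  finally show ?thesis
    using expected_cost_le[OF rs] K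
    by (simp add: solution_cost_def S_def N_def)
       (smt (verit, best) mult_left_mono mult.assoc)
qed

section \<open>Comparison with the optimum\<close>

lemma finite_final_clients: "finite (final_clients rs)"
proof -
  have "finite B \<Longrightarrow> finite (active_from B rs)" for B
    by (induction B rs rule: active_from.induct) auto
  then show ?thesis by (simp add: final_clients_def)
qed

lemma le_opt_cost:
  assumes "0 \<le> c"
    and "\<And>F a. F \<subseteq> A \<Longrightarrow> \<forall>x\<in>A. a x \<in> F \<Longrightarrow> v \<le> c * solution_cost \<delta> A F a"
  shows "v \<le> c * opt_cost \<delta> A"
proof (cases "c = 0")
  case True
  \<comment> \<open>Division by \<open>c\<close> is impossible here; the solution that opens every
    client already gives \<open>v \<le> 0\<close>.\<close>
  then show ?thesis using assms(2)[of A "\<lambda>x. x"] by simp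
next
  case False
  then have "0 < c" using assms(1) by simp
  have "v / c \<le> opt_cost \<delta> A"
    unfolding opt_cost_def
  proof (rule cInf_greatest)
    show "{solution_cost \<delta> A F a |F a. F \<subseteq> A \<and> (\<forall>x\<in>A. a x \<in> F)} \<noteq> {}"
      by (auto intro!: exI[of _ A] exI[of _ "\<lambda>x. x"])
    fix r assume "r \<in> {solution_cost \<delta> A F a |F a. F \<subseteq> A \<and> (\<forall>x\<in>A. a x \<in> F)}"
    then obtain F a where "r = solution_cost \<delta> A F a" "F \<subseteq> A" "\<forall>x\<in>A. a x \<in> F" by auto
    with assms(2)[of F a] have "v \<le> c * r" by simp
    then show "v / c \<le> r" using \<open>0 < c\<close> by (simp add: field_simps)
  qed
  then show ?thesis using \<open>0 < c\<close> by (simp add: field_simps)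
qed

lemma algorithm1_competitive:
  fixes M :: "'a set"
  assumes M: "Metric_space M d" "range loc \<subseteq> M"
    and near: "nearest_rule (client_dist d loc) near" and ord: "order_rule ord" and K: "2 \<le> K"
    and pass: "\<And>x y p. 0 \<le> p \<Longrightarrow> test (client_dist d loc x y) p \<Longrightarrow> client_dist d loc x y \<le> K * p"
    and fail: "\<And>t p. \<not> test t p \<Longrightarrow> 2 * p \<le> t"
  shows "competitive (client_dist d loc) (algorithm1 test (client_dist d loc) near ord)
           (\<lambda>N. (1 + K) * ratio N)"
proof -
  interpret Metric_space M d by (fact M)
  have loc: "loc x \<in> M" for x using M(2) by auto
  \<comment> \<open>Reversing the last distance builds symmetry into the triangle
    inequality.\<close>
  have "client_dist d loc x z \<le> client_dist d loc x y + client_dist d loc z y" for x y z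
    using triangle[OF loc[of x] loc[of y] loc[of z]] commute[of "loc z"]
    by (simp add: client_dist_def)
  moreover have "client_dist d loc x x = 0" "0 \<le> client_dist d loc x y" for x y
    using loc by (auto simp: client_dist_def)
  ultimately show ?thesis
    unfolding competitive_def using near ord K pass fail finite_final_clients ratio_nonneg
    by (auto intro!: le_opt_cost expected_cost_le_solution)
qed

theorem theorem2:
  shows "\<exists>\<alpha> :: nat \<Rightarrow> real.
    \<alpha> \<in> O(\<lambda>N. ln (real N) / ln (ln (real N))) \<and>
    (\<forall>(M :: 'a set) (d :: 'a \<Rightarrow> 'a \<Rightarrow> real) (loc :: client \<Rightarrow> 'a) near ord.
       Metric_space M d \<longrightarrow> range loc \<subseteq> M \<longrightarrow>
       nearest_rule (client_dist d loc) near \<longrightarrow> order_rule ord \<longrightarrow>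
         competitive (client_dist d loc)
           (algorithm1 uncapped_test (client_dist d loc) near ord) \<alpha> \<and>
         (\<forall>D\<ge>1. (\<forall>x\<in>M. \<forall>y\<in>M. d x y \<le> D) \<longrightarrow>
            competitive (client_dist d loc)
              (algorithm1 capped_test (client_dist d loc) near ord) (\<lambda>N. D * \<alpha> N)))"
\<comment> \<open>The factor 3 is \<open>1 + K\<close> for \<open>K = 2\<close>, the constant of the
  uncapped test.\<close>
proof (intro exI[of _ "\<lambda>N. 3 * ratio N"] conjI allI impI)
  show "(\<lambda>N. 3 * ratio N) \<in> O(\<lambda>N. ln (real N) / ln (ln (real N)))"
    using ratio_bigo by simp
next
  fix M :: "'a set" and d :: "'a \<Rightarrow> 'a \<Rightarrow> real" and loc near ord
  assume asms: "Metric_space M d" "range loc \<subseteq> M"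
    "nearest_rule (client_dist d loc) near" "order_rule ord"
  show "competitive (client_dist d loc)
      (algorithm1 uncapped_test (client_dist d loc) near ord) (\<lambda>N. 3 * ratio N)"
    using algorithm1_competitive[OF asms, of 2 uncapped_test] by (simp add: uncapped_test_def)
  fix D :: real
  assume D: "1 \<le> D" "\<forall>x\<in>M. \<forall>y\<in>M. d x y \<le> D"
  have "client_dist d loc x y \<le> 2 * D * p"
    if p: "0 \<le> p" and t: "capped_test (client_dist d loc x y) p" for x y p
  proof (cases "client_dist d loc x y \<le> 1")
    case True
    then have "client_dist d loc x y \<le> 2 * p" using t by (simp add: capped_test_def min_def)
    also have "\<dots> \<le> 2 * D * p" using D(1) p mult_right_mono[of 1 D p] by simp
    finally show ?thesis .
  next
    case False
    \<comment> \<open>Above distance 1 the capped test yields only this bound; the diameter bound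
      \<open>D\<close> then gives the constant \<open>K = 2 * D\<close>.\<close>
    then have "1 \<le> 2 * p" using t by (simp add: capped_test_def min_def)
    have "client_dist d loc x y \<le> D * 1" using D(2) asms(2) by (simp add: client_dist_def range_subsetD)
    also have "\<dots> \<le> D * (2 * p)" using D(1) \<open>1 \<le> 2 * p\<close> by (intro mult_left_mono) auto
    finally show ?thesis by simp
  qed
  moreover have "2 * p \<le> t" if "\<not> capped_test t p" for t p
    using that by (simp add: capped_test_def)
  ultimately have comp: "competitive (client_dist d loc)
      (algorithm1 capped_test (client_dist d loc) near ord) (\<lambda>N. (1 + 2 * D) * ratio N)"
    using D(1) by (intro algorithm1_competitive[OF asms]) auto
  have "(1 + 2 * D) * ratio N * opt_cost (client_dist d loc) A \<le>
        D * (3 * ratio N) * opt_cost (client_dist d loc) A" for N A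
  proof -
    \<comment> \<open>A nonnegative optimum allows the factor \<open>1 + 2 * D\<close> to be
      enlarged to \<open>3 * D\<close>.\<close>
    have "0 \<le> 1 * opt_cost (client_dist d loc) A"
      using Metric_space.nonneg[OF asms(1)]
      by (intro le_opt_cost) (auto simp: solution_cost_def client_dist_def sum_nonneg)
    moreover have "(1 + 2 * D) * ratio N \<le> (D * 3) * ratio N"
      using D(1) ratio_nonneg[of N] by (intro mult_right_mono) auto
    ultimately show ?thesis
      by (intro mult_right_mono) (auto simp: mult.assoc)
  qed
  then show "competitive (client_dist d loc)
      (algorithm1 capped_test (client_dist d loc) near ord) (\<lambda>N. D * (3 * ratio N))"
    using comp unfolding competitive_def by (meson order.trans)
qed

end
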